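(* Let $f:\mathbb{N}\to\mathbb{C}$ be a multiplicative function with bounded partial sums, and assume that $\sum_{p}\frac{|1-f(p)|}{p}<\infty$, where the sum runs over all primes $p$. Then there exists a prime $q$ such that $$\sum_{k=0}^\infty \frac{f(q^k)}{q^k}=0.$$
   Context: $\mathbb{N}=\{1,2,3,\dots\}$. A function $f:\mathbb{N}\to\mathbb{C}$ is multiplicative if $f(1)=1$ and $f(nm)=f(n)f(m)$ whenever $n$ and $m$ are relatively prime. $f$ has bounded partial sums if there exists a constant $C>0$ such that $|\sum_{n\leq x}f(n)|\leq C$ for all $x\geq 1$. *)

theory Defs
  imports "HOL-Analysis.Infinite_Sum" "HOL-Computational_Algebra.Primes"
begin

text \<open>
  Arithmetic functions on the positive integers are modelled as functions on
  \<^typ>\<open>nat\<close> whose value at \<open>0\<close> is unconstrained and never used.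
\<close>

definition multiplicative_fun :: "(nat \<Rightarrow> complex) \<Rightarrow> bool" where
  "multiplicative_fun f \<longleftrightarrow>
     f 1 = 1 \<and> (\<forall>n\<ge>1. \<forall>m\<ge>1. coprime n m \<longrightarrow> f (n * m) = f n * f m)"

definition bounded_partial_sums :: "(nat \<Rightarrow> complex) \<Rightarrow> bool" where
  "bounded_partial_sums f \<longleftrightarrow>
     (\<exists>C::real. C > 0 \<and> (\<forall>x::real. x \<ge> 1 \<longrightarrow> norm (\<Sum>n | 1 \<le> n \<and> real n \<le> x. f n) \<le> C))"

end

theory Submission
  imports Defs "HOL-Analysis.Infinite_Products" "HOL-Analysis.Uniform_Limit"
begin

text \<open>
  Write \<open>f = 1 * h\<close> as a Dirichlet convolution, where \<open>h = \<mu> * f\<close> is multiplicative with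
  \<open>h(p^k) = f(p^k) - f(p^(k-1))\<close>.  Bounded partial sums force \<open>f\<close> itself to be bounded, so the terms
  \<open>h(p^k) / p^k\<close> with \<open>k \<ge> 2\<close> contribute \<open>O(1/p^2)\<close> for each prime \<open>p\<close>, while \<open>k = 1\<close> contributes
  \<open>|1 - f(p)| / p\<close>, which is summable over \<open>p\<close> by assumption.  Hence \<open>\<Sum> |h(n)| / n\<close> converges
  (lemma \<open>summable_multiplicative_fun\<close>).

  Under this absolute convergence \<open>f\<close> has the mean value \<open>\<Sum> h(n) / n\<close> (Wintner's theorem,
  \<open>wintner_mean_value\<close>).  Since the partial sums of \<open>f\<close> are bounded, its mean value is \<open>0\<close>.  On the
  other hand \<open>\<Sum> h(n) / n\<close> is an absolutely convergent Euler product, and such a product vanishes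
  only if one of its factors does (\<open>euler_product_zero_factor\<close>).  By telescoping, the factor at \<open>q\<close>
  is \<open>(1 - 1/q) \<Sum> f(q^k) / q^k\<close> (\<open>moebius_transform_euler_factor\<close>), and \<open>1 - 1/q \<noteq> 0\<close>.

  Both interchanges of limit and sum, in Wintner's theorem and in the passage from finite to
  infinite Euler products, are instances of Tannery's theorem with a dominating series
  \<open>\<Sum> |h(n)| / n\<close>.
\<close>

section \<open>Multiplicative functions\<close>

lemma multiplicative_funD:
  assumes "multiplicative_fun f"
  shows "f 1 = 1" and "n > 0 \<Longrightarrow> m > 0 \<Longrightarrow> coprime n m \<Longrightarrow> f (n * m) = f n * f m"
  using assms by (auto simp: multiplicative_fun_def)

lemma multiplicative_fun_divide_of_nat:
  assumes "multiplicative_fun f"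
  shows "multiplicative_fun (\<lambda>n. f n / of_nat n)"
  using multiplicative_funD[OF assms] by (auto simp: multiplicative_fun_def)

lemma multiplicative_fun_norm:
  assumes "multiplicative_fun f"
  shows "multiplicative_fun (\<lambda>n. of_real (norm (f n)))"
  using multiplicative_funD[OF assms] by (auto simp: multiplicative_fun_def norm_mult)

text \<open>
  Splitting off the full power of one prime factor leaves a strictly smaller coprime cofactor, so a
  multiplicative function is determined by its values at prime powers.
\<close>
lemma multiplicative_fun_eqI:
  assumes f: "multiplicative_fun f" and g: "multiplicative_fun g"
    and eq: "\<And>p k. prime p \<Longrightarrow> f (p ^ k) = g (p ^ k)" and "n > 0"
  shows "f n = g n"
  using \<open>n > 0\<close>
proof (induction n rule: less_induct)
  case (less n)
  show ?case
  proof (cases "n = 1")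
    case True
    then show ?thesis using multiplicative_funD(1) f g by metis
  next
    case False
    then obtain p where p: "prime p" "p dvd n" using prime_factor_nat by blast
    then obtain m where m: "n = p ^ multiplicity p n * m" "\<not> p dvd m"
      using less.prems multiplicity_decompose'[of n p] by (metis not_prime_unit gr_implies_not0)
    have pos: "m > 0" "p ^ multiplicity p n > 0"
      using less.prems m(1) by (metis gr0I mult_0_right, simp add: p prime_gt_0_nat)
    have "multiplicity p n > 0"
      using p less.prems by (simp add: prime_multiplicity_gt_zero_iff)
    then have "p ^ multiplicity p n > 1"
      using p by (metis one_less_power prime_gt_1_nat)
    then have "m < n" using m(1) pos by (metis mult_less_cancel2 nat_mult_1)
    have cop: "coprime (p ^ multiplicity p n) m"
      using p m(2) by (simp add: prime_imp_coprime)
    show ?thesis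
      using multiplicative_funD(2)[OF f pos(2,1) cop] multiplicative_funD(2)[OF g pos(2,1) cop]
        eq[OF p(1)] less.IH[OF \<open>m < n\<close> pos(1)] m(1) by simp
  qed
qed

text \<open>
  For coprime \<open>n\<close> and \<open>m\<close> every divisor of \<open>n * m\<close> is a unique product of a divisor of \<open>n\<close> and a
  divisor of \<open>m\<close>, recovered by taking greatest common divisors.
\<close>
lemma multiplicative_fun_sum_divisors:
  assumes h: "multiplicative_fun h"
  shows "multiplicative_fun (\<lambda>n. \<Sum>d | d dvd n. h d)"
  unfolding multiplicative_fun_def
proof (intro conjI allI impI)
  show "(\<Sum>d | d dvd 1. h d) = 1"
    using multiplicative_funD(1)[OF h] by simp
next
  fix n m :: nat
  assume nm: "1 \<le> n" "1 \<le> m" "coprime n m"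
  let ?D = "{d. d dvd n} \<times> {e. e dvd m}"
  have cop: "coprime d m" "coprime e n" "coprime d e" if "d dvd n" "e dvd m" for d e
    using that nm(3) by (meson coprime_divisors coprime_commute dvd_refl)+
  have inj: "inj_on (\<lambda>(d, e). d * e) ?D"
  proof (rule inj_on_inverseI[where g = "\<lambda>c. (gcd c n, gcd c m)"])
    fix de assume "de \<in> ?D"
    then obtain d e where de: "de = (d, e)" "d dvd n" "e dvd m" by auto
    have "gcd (d * e) n = gcd d n"
      using cop[OF de(2,3)] by (intro gcd_mult_left_right_cancel) (simp add: coprime_commute)
    moreover have "gcd (d * e) m = gcd e m"
      using cop[OF de(2,3)] by (intro gcd_mult_left_left_cancel) (simp add: coprime_commute)
    ultimately show "(\<lambda>c. (gcd c n, gcd c m)) (case de of (d, e) \<Rightarrow> d * e) = de"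
      using de by (simp add: gcd_nat.absorb1)
  qed
  have "{c. c dvd n * m} = (\<lambda>(d, e). d * e) ` ?D"
    by (auto intro: mult_dvd_mono elim!: dvd_productE)
  then have "(\<Sum>c | c dvd n * m. h c) = (\<Sum>(d, e) \<in> ?D. h (d * e))"
    using inj by (simp add: sum.reindex case_prod_unfold)
  also have "\<dots> = (\<Sum>(d, e) \<in> ?D. h d * h e)"
  proof (intro sum.cong refl, clarify)
    fix d e assume "d dvd n" "e dvd m"
    then show "h (d * e) = h d * h e"
      using nm cop by (intro multiplicative_funD(2)[OF h]) (auto intro: dvd_pos_nat)
  qed
  also have "\<dots> = (\<Sum>d | d dvd n. h d) * (\<Sum>d | d dvd m. h d)"
    by (simp add: sum_product sum.cartesian_product)
  finally show "(\<Sum>d | d dvd n * m. h d) = (\<Sum>d | d dvd n. h d) * (\<Sum>d | d dvd m. h d)" .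
qed

text \<open>
  For multiplicative \<open>f\<close> this is the Dirichlet convolution \<open>\<mu> * f\<close>.  The product over prime powers
  makes it multiplicative by construction and gives its values at prime powers directly.
\<close>
definition moebius_transform :: "(nat \<Rightarrow> complex) \<Rightarrow> nat \<Rightarrow> complex" where
  "moebius_transform f n =
     (\<Prod>p \<in> prime_factors n. f (p ^ multiplicity p n) - f (p ^ (multiplicity p n - 1)))"

lemma multiplicative_fun_moebius_transform: "multiplicative_fun (moebius_transform f)"
  unfolding multiplicative_fun_def
proof (intro conjI allI impI)
  show "moebius_transform f 1 = 1" by (simp add: moebius_transform_def)
next
  fix n m :: nat
  assume nm: "1 \<le> n" "1 \<le> m" "coprime n m"
  have disj: "\<not> (p dvd n \<and> p dvd m)" if "prime p" for p
    using that nm(3) not_prime_unit coprime_common_divisor by blast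
  have 1: "multiplicity p (n * m) = multiplicity p n" if "p \<in> prime_factors n" for p
    using that disj[of p] nm by (subst prime_elem_multiplicity_mult_distrib)
      (auto simp: prime_factors_dvd not_dvd_imp_multiplicity_0)
  have 2: "multiplicity p (n * m) = multiplicity p m" if "p \<in> prime_factors m" for p
    using that disj[of p] nm by (subst prime_elem_multiplicity_mult_distrib)
      (auto simp: prime_factors_dvd not_dvd_imp_multiplicity_0)
  have "prime_factors n \<inter> prime_factors m = {}"
    using disj nm by (auto simp: prime_factors_dvd)
  moreover have "prime_factors (n * m) = prime_factors n \<union> prime_factors m"
    using nm by (subst prime_factorization_mult) auto
  ultimately show "moebius_transform f (n * m) = moebius_transform f n * moebius_transform f m"
    unfolding moebius_transform_def using 1 2
    by (simp add: prod.union_disjoint cong: prod.cong)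
qed

lemma moebius_transform_prime_power_Suc:
  assumes "prime p"
  shows "moebius_transform f (p ^ Suc k) = f (p ^ Suc k) - f (p ^ k)"
  using assms unfolding moebius_transform_def
  by (subst prime_factorization_prime_power) (auto simp del: power_Suc)

text \<open>
  Moebius inversion: both sides are multiplicative, and at a prime power the sum telescopes.
\<close>
lemma sum_divisors_moebius_transform:
  assumes f: "multiplicative_fun f" and "n > 0"
  shows "(\<Sum>d | d dvd n. moebius_transform f d) = f n"
proof (rule multiplicative_fun_eqI[OF multiplicative_fun_sum_divisors f _ \<open>n > 0\<close>])
  show "multiplicative_fun (moebius_transform f)" by (rule multiplicative_fun_moebius_transform)
next
  fix p k :: nat assume p: "prime p"
  have "{d. d dvd p ^ k} = (\<lambda>i. p ^ i) ` {..k}"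
    using p by (auto simp: divides_primepow_nat le_imp_power_dvd)
  moreover have "inj_on (\<lambda>i. p ^ i) {..k}"
    using p by (auto simp: inj_on_def dest: prime_gt_1_nat)
  ultimately have "(\<Sum>d | d dvd p ^ k. moebius_transform f d)
      = (\<Sum>i\<le>k. moebius_transform f (p ^ i))"
    by (simp add: sum.reindex)
  also have "\<dots> = f (p ^ k)"
  proof (induction k)
    case 0
    show ?case using multiplicative_funD(1)[OF f] by (simp add: moebius_transform_def)
  qed (use p in \<open>simp add: moebius_transform_prime_power_Suc del: power_Suc\<close>)
  finally show "(\<Sum>d | d dvd p ^ k. moebius_transform f d) = f (p ^ k)" .
qed

section \<open>Euler products\<close>

definition smooth_nats :: "nat set \<Rightarrow> nat set" where
  "smooth_nats T = {n. n > 0 \<and> prime_factors n \<subseteq> T}"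

lemma bij_betw_smooth_nats_insert:
  assumes p: "prime p" "p \<notin> T"
  shows "bij_betw (\<lambda>(k, m). p ^ k * m) (UNIV \<times> smooth_nats T) (smooth_nats (insert p T))"
proof (rule bij_betw_byWitness[where f' = "\<lambda>n. (multiplicity p n, n div p ^ multiplicity p n)"])
  have np: "\<not> p dvd m" if "m \<in> smooth_nats T" for m
    using that p by (auto simp: smooth_nats_def prime_factors_dvd)
  have *: "multiplicity p (p ^ k * m) = k" if "m \<in> smooth_nats T" for k m
    using np[OF that] p that
    by (subst prime_elem_multiplicity_mult_distrib)
       (auto simp: not_dvd_imp_multiplicity_0 smooth_nats_def)
  then show "\<forall>a\<in>UNIV \<times> smooth_nats T. (\<lambda>n. (multiplicity p n, n div p ^ multiplicity p n))
      (case a of (k, m) \<Rightarrow> p ^ k * m) = a"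
    using p by (auto simp: prime_gt_0_nat)
  show "\<forall>n\<in>smooth_nats (insert p T).
      (case (multiplicity p n, n div p ^ multiplicity p n) of (k, m) \<Rightarrow> p ^ k * m) = n"
    by (auto simp: multiplicity_dvd)
  show "(\<lambda>(k, m). p ^ k * m) ` (UNIV \<times> smooth_nats T) \<subseteq> smooth_nats (insert p T)"
  proof (clarify)
    fix k m assume "m \<in> smooth_nats T"
    moreover from this have "prime_factors (p ^ k * m) = prime_factors (p ^ k) \<union> prime_factors m"
      using p by (subst prime_factorization_mult) (auto simp: smooth_nats_def)
    moreover have "prime_factors (p ^ k) \<subseteq> {p}"
      using p by (auto simp: prime_factorization_prime_power)
    ultimately show "p ^ k * m \<in> smooth_nats (insert p T)"
      using p by (auto simp: smooth_nats_def prime_gt_0_nat)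
  qed
  show "(\<lambda>n. (multiplicity p n, n div p ^ multiplicity p n)) ` smooth_nats (insert p T)
      \<subseteq> UNIV \<times> smooth_nats T"
  proof (clarsimp)
    fix n assume n: "n \<in> smooth_nats (insert p T)"
    then have "n > 0" by (simp add: smooth_nats_def)
    then obtain m where m: "n = p ^ multiplicity p n * m" "\<not> p dvd m"
      using p multiplicity_decompose'[of n p] by (metis not_prime_unit gr_implies_not0)
    then have "n div p ^ multiplicity p n = m"
      using p by (metis nonzero_mult_div_cancel_left power_not_zero not_prime_0)
    moreover have "m > 0" "m dvd n" using m \<open>n > 0\<close> by (metis gr0I dvd_0_right, metis dvd_triv_right)
    ultimately show "n div p ^ multiplicity p n \<in> smooth_nats T"
      using n m(2) \<open>n > 0\<close> by (auto simp: smooth_nats_def prime_factors_dvd dest: dvd_trans)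
  qed
qed

text \<open>
  Adding a prime \<open>p\<close> to \<open>T\<close> turns the sum over smooth numbers into a product of two absolutely
  convergent sums, since each new smooth number is uniquely \<open>p ^ k * m\<close> with \<open>m\<close> smooth over \<open>T\<close>.
\<close>
lemma finite_euler_product:
  fixes g :: "nat \<Rightarrow> complex"
  assumes g: "multiplicative_fun g" and "finite T"
    and "\<And>p. p \<in> T \<Longrightarrow> prime p"
    and "\<And>p. p \<in> T \<Longrightarrow> summable (\<lambda>k. norm (g (p ^ k)))"
  shows "(\<lambda>n. norm (g n)) summable_on smooth_nats T"
    and "(g has_sum (\<Prod>p\<in>T. \<Sum>k. g (p ^ k))) (smooth_nats T)"
proof -
  have "(\<lambda>n. norm (g n)) summable_on smooth_nats T \<and>
        (g has_sum (\<Prod>p\<in>T. \<Sum>k. g (p ^ k))) (smooth_nats T)"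
    using assms(2-)
  proof (induction T)
    case empty
    have "prime_factors n = {} \<longleftrightarrow> n = 0 \<or> n = 1" for n :: nat
      by (metis prime_factorization_empty_iff set_mset_eq_empty_iff nat_dvd_1_iff_1)
    then have "smooth_nats {} = {1}"
      unfolding smooth_nats_def by (intro set_eqI) (simp, linarith)
    moreover have "(g has_sum 1) {1}"
      using multiplicative_funD(1)[OF g] by (intro has_sum_finiteI) simp_all
    ultimately show ?case by simp
  next
    case (insert p T)
    then have p: "prime p" and sump: "summable (\<lambda>k. norm (g (p ^ k)))"
      and IH: "(\<lambda>n. norm (g n)) summable_on smooth_nats T"
        "(g has_sum (\<Prod>p\<in>T. \<Sum>k. g (p ^ k))) (smooth_nats T)"
      by auto
    have prodg: "g (p ^ k * m) = g (p ^ k) * g m" if "m \<in> smooth_nats T" for k m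
      using that p insert.hyps
      by (intro multiplicative_funD(2)[OF g])
         (auto simp: smooth_nats_def prime_gt_0_nat prime_factors_dvd intro!: prime_imp_coprime)
    let ?G = "\<lambda>(k, m). g (p ^ k) * g m"
    have gp: "(\<lambda>k. norm (g (p ^ k))) summable_on UNIV"
      using sump by (simp add: summable_nonneg_imp_summable_on)
    have hp: "((\<lambda>k. g (p ^ k)) has_sum (\<Sum>k. g (p ^ k))) UNIV"
      using sump by (intro norm_summable_imp_has_sum) (auto simp: summable_norm_cancel summable_sums)
    have abs: "?G abs_summable_on (UNIV \<times> smooth_nats T)"
      unfolding abs_summable_on_Sigma_iff
      using IH(1) gp
      by (auto simp: norm_mult infsum_cmult_right' abs_mult intro!: summable_on_cmult_right summable_on_cmult_left
          abs_of_nonneg infsum_nonneg)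
    have sumG: "(?G has_sum (\<Sum>k. g (p ^ k)) * (\<Prod>p\<in>T. \<Sum>k. g (p ^ k))) (UNIV \<times> smooth_nats T)"
    proof (rule has_sum_SigmaI)
      show "?G summable_on UNIV \<times> smooth_nats T" using abs by (rule abs_summable_summable)
      show "((\<lambda>m. ?G (k, m)) has_sum g (p ^ k) * (\<Prod>p\<in>T. \<Sum>k. g (p ^ k))) (smooth_nats T)" for k
        using IH(2) by (auto intro: has_sum_cmult_right)
      show "((\<lambda>k. g (p ^ k) * (\<Prod>p\<in>T. \<Sum>k. g (p ^ k))) has_sum
          (\<Sum>k. g (p ^ k)) * (\<Prod>p\<in>T. \<Sum>k. g (p ^ k))) UNIV"
        using hp by (rule has_sum_cmult_left)
    qed
    note bij = bij_betw_smooth_nats_insert[OF p insert.hyps(2)]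
    have eq: "g (case x of (k, m) \<Rightarrow> p ^ k * m) = ?G x" if "x \<in> UNIV \<times> smooth_nats T" for x
      using that by (auto simp: prodg)
    have "(g has_sum (\<Sum>k. g (p ^ k)) * (\<Prod>p\<in>T. \<Sum>k. g (p ^ k))) (smooth_nats (insert p T))"
      unfolding has_sum_reindex_bij_betw[OF bij, symmetric]
      using sumG by (subst has_sum_cong[OF eq]) simp_all
    moreover have "(\<lambda>n. norm (g n)) summable_on smooth_nats (insert p T)"
      unfolding summable_on_reindex_bij_betw[OF bij, symmetric]
      using abs by (subst summable_on_cong[OF arg_cong[OF eq]]) simp_all
    ultimately show ?case using insert.hyps by simp
  qed
  then show "(\<lambda>n. norm (g n)) summable_on smooth_nats T"
    "(g has_sum (\<Prod>p\<in>T. \<Sum>k. g (p ^ k))) (smooth_nats T)" by auto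
qed

lemma local_euler_factor_split:
  fixes g :: "nat \<Rightarrow> complex"
  assumes g: "multiplicative_fun g" and "summable (\<lambda>k. norm (g (p ^ k)))"
  shows "(\<Sum>k. g (p ^ k)) = 1 + (\<Sum>k. g (p ^ Suc k))"
    and "(\<Sum>k. norm (g (p ^ k))) = 1 + (\<Sum>k. norm (g (p ^ Suc k)))"
  using suminf_split_head[OF summable_norm_cancel[OF assms(2)]] suminf_split_head[OF assms(2)]
    multiplicative_funD(1)[OF g] by (simp_all add: algebra_simps)

text \<open>
  With \<open>e p = \<Sum>k\<ge>1. |g(p^k)|\<close>, the finite Euler product of \<open>|g|\<close> over the primes below \<open>N\<close> is
  \<open>\<Prod> (1 + e p) \<le> exp (\<Sum> e p)\<close>, and it dominates the sum of \<open>|g(n)|\<close> over \<open>n < N\<close>.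
  The convention \<open>g 0 = 0\<close> lets series over all naturals stand for sums over positive integers.
\<close>
lemma summable_multiplicative_fun:
  fixes g :: "nat \<Rightarrow> complex"
  assumes g: "multiplicative_fun g" and "g 0 = 0"
    and sump: "\<And>p. prime p \<Longrightarrow> summable (\<lambda>k. norm (g (p ^ k)))"
    and sumP: "summable (\<lambda>p. if prime p then \<Sum>k. norm (g (p ^ Suc k)) else 0)"
  shows "summable (\<lambda>n. norm (g n))"
proof (rule summableI_nonneg_bounded)
  define e where "e p = (if prime p then \<Sum>k. norm (g (p ^ Suc k)) else 0)" for p :: nat
  have e0: "e p \<ge> 0" for p
    using sump[of p] summable_Suc_iff[of "\<lambda>k. norm (g (p ^ k))"]
    by (auto simp: e_def simp del: power_Suc intro!: suminf_nonneg)
  show "norm (g n) \<ge> 0" for n by simp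
  show "(\<Sum>n<N. norm (g n)) \<le> exp (\<Sum>p. e p)" for N
  proof -
    let ?P = "{p. prime p \<and> p < N}"
    \<comment> \<open>The finite Euler product is applied to \<open>|g|\<close>, viewed as a complex multiplicative function.\<close>
    have "((\<lambda>n. complex_of_real (norm (g n))) has_sum
        (\<Prod>p\<in>?P. \<Sum>k. complex_of_real (norm (g (p ^ k))))) (smooth_nats ?P)"
      using sump by (intro finite_euler_product(2) multiplicative_fun_norm g) auto
    also have "(\<Prod>p\<in>?P. \<Sum>k. complex_of_real (norm (g (p ^ k))))
        = of_real (\<Prod>p\<in>?P. \<Sum>k. norm (g (p ^ k)))"
      using sump by (simp add: suminf_of_real)
    finally have sums: "((\<lambda>n. norm (g n)) has_sum (\<Prod>p\<in>?P. \<Sum>k. norm (g (p ^ k)))) (smooth_nats ?P)"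
      by (simp only: has_sum_of_real_iff)
    have "{0<..<N} \<subseteq> smooth_nats ?P"
      by (auto simp: smooth_nats_def prime_factors_dvd dest!: dvd_imp_le)
    then have "(\<Sum>n\<in>{0<..<N}. norm (g n)) \<le> (\<Prod>p\<in>?P. \<Sum>k. norm (g (p ^ k)))"
      using sums by (intro finite_sum_le_has_sum) auto
    moreover have "(\<Sum>n<N. norm (g n)) = (\<Sum>n\<in>{0<..<N}. norm (g n))"
      using \<open>g 0 = 0\<close> by (intro sum.mono_neutral_right) auto
    moreover have "(\<Prod>p\<in>?P. \<Sum>k. norm (g (p ^ k))) = (\<Prod>p\<in>?P. 1 + e p)"
      using sump by (intro prod.cong) (auto simp: e_def local_euler_factor_split(2)[OF g] simp del: power_Suc)
    moreover have "(\<Prod>p\<in>?P. 1 + e p) \<le> (\<Prod>p\<in>?P. exp (e p))"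
      using e0 by (intro prod_mono) (auto intro: add_nonneg_nonneg)
    moreover have "(\<Prod>p\<in>?P. exp (e p)) = exp (\<Sum>p\<in>?P. e p)"
      by (simp add: exp_sum)
    moreover have "(\<Sum>p\<in>?P. e p) \<le> (\<Sum>p. e p)"
      using sumP e0 by (intro sum_le_suminf) (auto simp: e_def)
    ultimately show ?thesis by (smt (verit) exp_le_cancel_iff)
  qed
qed

text \<open>
  The finite product is the sum of \<open>g\<close> over the \<open>N\<close>-smooth numbers.  Each \<open>n > 0\<close> is \<open>N\<close>-smooth as
  soon as \<open>n \<le> N\<close>, so Tannery's theorem with dominating series \<open>|g(n)|\<close> gives the limit.
\<close>
theorem euler_product:
  fixes g :: "nat \<Rightarrow> complex"
  assumes g: "multiplicative_fun g" and "g 0 = 0"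
    and sum: "summable (\<lambda>n. norm (g n))"
    and sump: "\<And>p. prime p \<Longrightarrow> summable (\<lambda>k. norm (g (p ^ k)))"
  shows "(\<lambda>N. \<Prod>p | prime p \<and> p \<le> N. \<Sum>k. g (p ^ k)) \<longlonglongrightarrow> (\<Sum>n. g n)"
proof -
  define P where "P N = {p. prime p \<and> p \<le> N}" for N :: nat
  define a where "a n N = (if n \<in> smooth_nats (P N) then g n else 0)" for n N
  have "(\<lambda>N. \<Sum>n. a n N) \<longlonglongrightarrow> (\<Sum>n. g n)"
  proof (rule tannerys_theorem[THEN conjunct2, THEN conjunct2])
    show "(\<lambda>N. a n N) \<longlonglongrightarrow> g n" for n
    proof (rule tendsto_eventually, rule eventually_sequentiallyI)
      fix N assume "n \<le> N"
      then show "a n N = g n"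
        using \<open>g 0 = 0\<close> by (cases "n = 0")
          (auto simp: a_def smooth_nats_def P_def prime_factors_dvd dest!: dvd_imp_le)
    qed
    show "\<forall>\<^sub>F (n, N) in sequentially \<times>\<^sub>F sequentially. norm (a n N) \<le> norm (g n)"
      by (auto simp: a_def intro: always_eventually)
  qed (use sum in auto)
  moreover have "(\<Sum>n. a n N) = (\<Prod>p\<in>P N. \<Sum>k. g (p ^ k))" for N
  proof -
    have "(g has_sum (\<Prod>p\<in>P N. \<Sum>k. g (p ^ k))) (smooth_nats (P N))"
      using sump by (intro finite_euler_product(2) g) (auto simp: P_def)
    then have "((\<lambda>n. a n N) has_sum (\<Prod>p\<in>P N. \<Sum>k. g (p ^ k))) UNIV"
      by (subst has_sum_cong_neutral[where g = g and T = "smooth_nats (P N)"]) (auto simp: a_def)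
    then show ?thesis by (metis has_sum_imp_sums sums_unique)
  qed
  ultimately show ?thesis by (simp add: P_def)
qed

text \<open>
  The factors differ from \<open>1\<close> by a summable amount, so the infinite product converges absolutely and
  its value can be \<open>0\<close> only if a factor is.
\<close>
corollary euler_product_zero_factor:
  fixes g :: "nat \<Rightarrow> complex"
  assumes g: "multiplicative_fun g" and "g 0 = 0"
    and sump: "\<And>p. prime p \<Longrightarrow> summable (\<lambda>k. norm (g (p ^ k)))"
    and sumP: "summable (\<lambda>p. if prime p then \<Sum>k. norm (g (p ^ Suc k)) else 0)"
    and zero: "(\<Sum>n. g n) = 0"
  shows "\<exists>q. prime q \<and> (\<Sum>k. g (q ^ k)) = 0"
proof (rule ccontr)
  assume nz: "\<not> ?thesis"
  define F where "F p = (if prime p then \<Sum>k. g (p ^ k) else 1)" for p :: nat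
  have "summable (\<lambda>p. norm (F p - 1))"
  proof (rule summable_comparison_test'[OF sumP])
    fix p :: nat
    show "norm (norm (F p - 1)) \<le> (if prime p then \<Sum>k. norm (g (p ^ Suc k)) else 0)"
    proof (cases "prime p")
      case True
      then have "summable (\<lambda>k. norm (g (p ^ Suc k)))"
        using summable_Suc_iff[of "\<lambda>k. norm (g (p ^ k))"] sump by simp
      then show ?thesis
        using True summable_norm[of "\<lambda>k. g (p ^ Suc k)"] local_euler_factor_split(1)[OF g sump]
        by (simp add: F_def)
    qed (simp add: F_def)
  qed
  then have "convergent_prod F"
    by (intro abs_convergent_prod_imp_convergent_prod summable_imp_abs_convergent_prod)
  moreover have "F p \<noteq> 0" for p using nz by (auto simp: F_def)
  ultimately have "prodinf F \<noteq> 0" and lim: "(\<lambda>N. \<Prod>p\<le>N. F p) \<longlonglongrightarrow> prodinf F"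
    by (auto intro: convergent_prod_LIMSEQ dest: prodinf_nonzero)
  have "(\<Prod>p\<le>N. F p) = (\<Prod>p | prime p \<and> p \<le> N. \<Sum>k. g (p ^ k))" for N
    by (rule prod.mono_neutral_cong_right) (auto simp: F_def)
  moreover have "(\<lambda>N. \<Prod>p | prime p \<and> p \<le> N. \<Sum>k. g (p ^ k)) \<longlonglongrightarrow> 0"
    using euler_product[OF g \<open>g 0 = 0\<close> summable_multiplicative_fun[OF g \<open>g 0 = 0\<close> sump sumP] sump]
      zero by simp
  ultimately have "prodinf F = 0" using lim LIMSEQ_unique by simp
  with \<open>prodinf F \<noteq> 0\<close> show False by simp
qed

section \<open>Mean values\<close>

text \<open>
  Exchanging the sums, \<open>h d\<close> is counted once for each multiple of \<open>d\<close> up to \<open>N\<close>.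
\<close>
lemma sum_sum_divisors:
  "(\<Sum>n=1..N. \<Sum>d | d dvd n. h d) = (\<Sum>d=1..N. of_nat (N div d) * (h d :: complex))"
proof -
  have "(\<Sum>n=1..N. \<Sum>d | d dvd n. h d) = (\<Sum>n=1..N. \<Sum>d | d \<in> {1..N} \<and> d dvd n. h d)"
    by (intro sum.cong refl) (auto dest: dvd_imp_le intro: Nat.gr0I intro!: Suc_leI)
  also have "\<dots> = (\<Sum>d=1..N. \<Sum>n | n \<in> {1..N} \<and> d dvd n. h d)"
    by (rule sum.swap_restrict) auto
  also have "\<dots> = (\<Sum>d=1..N. of_nat (N div d) * h d)"
  proof (rule sum.cong[OF refl])
    fix d assume d: "d \<in> {1..N}"
    have "{n. n \<in> {1..N} \<and> d dvd n} = (\<lambda>k. d * k) ` {1..N div d}"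
      using d by (auto simp: dvd_def less_eq_div_iff_mult_less_eq mult.commute Suc_le_eq)
    then have "card {n. n \<in> {1..N} \<and> d dvd n} = N div d"
      using d by (simp add: card_image inj_on_def)
    then show "(\<Sum>n | n \<in> {1..N} \<and> d dvd n. h d) = of_nat (N div d) * h d" by simp
  qed
  finally show ?thesis .
qed

lemma div_nat_tendsto: "(\<lambda>N. of_nat (N div d) / (of_nat N :: complex)) \<longlonglongrightarrow> 1 / of_nat d"
proof (cases "d = 0")
  case False
  have bound: "norm (real (N div d) / real N - 1 / real d) \<le> 1 / real N" if "N > 0" for N
  proof -
    have "real N = real d * real (N div d) + real (N mod d)"
      by (metis of_nat_add of_nat_mult mult_div_mod_eq)
    then have "real (N div d) / real N - 1 / real d = - (real (N mod d) / real d) / real N"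
      using that False by (simp add: field_simps)
    moreover have "real (N mod d) / real d / real N \<le> 1 / real N"
      using False by (intro divide_right_mono) simp_all
    ultimately show ?thesis by simp
  qed
  have "(\<lambda>N. real (N div d) / real N - 1 / real d) \<longlonglongrightarrow> 0"
    by (rule Lim_null_comparison[OF eventually_sequentiallyI[of 1] lim_1_over_n]) (use bound in auto)
  then have "(\<lambda>N. complex_of_real (real (N div d) / real N)) \<longlonglongrightarrow> of_real (1 / real d)"
    by (subst (asm) LIM_zero_iff) (rule tendsto_of_real)
  then show ?thesis by simp
qed simp

text \<open>
  The mean up to \<open>N\<close> is \<open>\<Sum>d. h d * (\<lfloor>N/d\<rfloor> / N)\<close>, where the weight tends to \<open>1/d\<close> and never exceeds
  it; Tannery's theorem applies.
\<close>
theorem wintner_mean_value: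
  fixes h :: "nat \<Rightarrow> complex"
  assumes sum: "summable (\<lambda>d. norm (h d / of_nat d))"
  shows "(\<lambda>N. (\<Sum>n=1..N. \<Sum>d | d dvd n. h d) / of_nat N) \<longlonglongrightarrow> (\<Sum>d. h d / of_nat d)"
proof -
  define a where "a d N = h d * (of_nat (N div d) / of_nat N)" for d N
  have "(\<lambda>N. \<Sum>d. a d N) \<longlonglongrightarrow> (\<Sum>d. h d / of_nat d)"
  proof (rule tannerys_theorem[THEN conjunct2, THEN conjunct2])
    show "(\<lambda>N. a d N) \<longlonglongrightarrow> h d / of_nat d" for d
      unfolding a_def using tendsto_mult_left[OF div_nat_tendsto, of "h d" d] by simp
    have "norm (a d N) \<le> norm (h d / of_nat d)" for d N
    proof -
      have "real (N div d) / real N \<le> 1 / real d"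
        using div_times_less_eq_dividend[of N d] by (cases "d = 0"; cases "N = 0")
          (auto simp: field_simps simp flip: of_nat_mult)
      then have "norm (h d) * (real (N div d) / real N) \<le> norm (h d) * (1 / real d)"
        by (intro mult_left_mono) auto
      then show ?thesis by (simp add: a_def norm_mult norm_divide)
    qed
    then show "\<forall>\<^sub>F (d, N) in sequentially \<times>\<^sub>F sequentially. norm (a d N) \<le> norm (h d / of_nat d)"
      by (auto intro: always_eventually)
  qed (use sum in auto)
  moreover have "(\<Sum>d. a d N) = (\<Sum>n=1..N. \<Sum>d | d dvd n. h d) / of_nat N" for N
  proof -
    have "a d N = 0" if "d \<notin> {1..N}" for d
      using that by (cases "d = 0") (auto simp: a_def)
    then have "(\<Sum>d. a d N) = (\<Sum>d=1..N. a d N)"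
      by (intro suminf_finite) auto
    also have "\<dots> = (\<Sum>d=1..N. of_nat (N div d) * h d) / of_nat N"
      by (simp add: a_def sum_divide_distrib mult.commute)
    finally show ?thesis by (simp only: sum_sum_divisors)
  qed
  ultimately show ?thesis by simp
qed

section \<open>Bounded partial sums\<close>

lemma bounded_partial_sumsD:
  assumes "bounded_partial_sums f"
  obtains C where "C > 0" "\<And>N. norm (\<Sum>n=1..N. f n) \<le> C"
proof -
  obtain C where C: "C > 0" "\<And>x::real. x \<ge> 1 \<Longrightarrow> norm (\<Sum>n | 1 \<le> n \<and> real n \<le> x. f n) \<le> C"
    using assms by (auto simp: bounded_partial_sums_def)
  have "norm (\<Sum>n=1..N. f n) \<le> C" for N
  proof (cases "N = 0")
    case False
    have "{n. 1 \<le> n \<and> real n \<le> real N} = {1..N}" by auto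
    then show ?thesis using C(2)[of "real N"] False by simp
  qed (use C(1) in simp)
  then show thesis using C(1) that by blast
qed

lemma mean_value_zero:
  assumes "bounded_partial_sums f"
  shows "(\<lambda>N. (\<Sum>n=1..N. f n) / of_nat N) \<longlonglongrightarrow> 0"
proof -
  obtain C where C: "\<And>N. norm (\<Sum>n=1..N. f n) \<le> C" using assms bounded_partial_sumsD by blast
  have "(\<lambda>N. C * (1 / real N)) \<longlonglongrightarrow> 0"
    using tendsto_mult_left[OF lim_1_over_n, of C] by simp
  then show ?thesis
  proof (rule Lim_null_comparison[rotated])
    show "\<forall>\<^sub>F N in sequentially. norm ((\<Sum>n=1..N. f n) / of_nat N) \<le> C * (1 / real N)"
      using divide_right_mono[OF C] by (simp add: norm_divide)
  qed
qed

text \<open>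
  Each value of \<open>f\<close> is a difference of two consecutive partial sums.
\<close>
lemma bounded_of_bounded_partial_sums:
  assumes "bounded_partial_sums f"
  obtains B where "B > 0" "\<And>n. n > 0 \<Longrightarrow> norm (f n) \<le> B"
proof -
  obtain C where C: "C > 0" "\<And>N. norm (\<Sum>n=1..N. f n) \<le> C" using assms bounded_partial_sumsD by blast
  have "norm (f n) \<le> 2 * C" if "n > 0" for n
  proof -
    have "f n = (\<Sum>k=1..n. f k) - (\<Sum>k=1..n - 1. f k)"
      using that by (cases n) simp_all
    then have "norm (f n) \<le> norm (\<Sum>k=1..n. f k) + norm (\<Sum>k=1..n - 1. f k)"
      by (simp only: norm_triangle_ineq4)
    then show ?thesis using C(2)[of n] C(2)[of "n - 1"] by linarith
  qed
  then show thesis using that[of "2 * C"] C(1) by simp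
qed


lemma summable_prime_power_series:
  fixes f :: "nat \<Rightarrow> complex"
  assumes "p > 1" and B: "\<And>n. n > 0 \<Longrightarrow> norm (f n) \<le> B"
  shows "summable (\<lambda>k. norm (f (p ^ k) / of_nat (p ^ k)))"
proof (rule summable_comparison_test')
  show "summable (\<lambda>k. B * (1 / real p) ^ k)"
    using \<open>p > 1\<close> by (intro summable_mult summable_geometric) simp
  show "norm (norm (f (p ^ k) / of_nat (p ^ k))) \<le> B * (1 / real p) ^ k" for k
    using B[of "p ^ k"] \<open>p > 1\<close> by (simp add: norm_divide norm_power power_divide divide_right_mono)
qed

text \<open>
  With \<open>a k = f(p^k) / p^k\<close> one has \<open>g(p^(k+1)) = a (k+1) - a k / p\<close>, and summation gives the factor
  \<open>1 - 1/p\<close>.  In the norm bound the term \<open>k = 0\<close> is kept exactly, because its crude bound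
  \<open>2B / p\<close> is not summable over the primes; the other terms are at most \<open>2B / p^(k+1)\<close>, a geometric
  series with sum at most \<open>4B / p\<^sup>2\<close>.
\<close>
lemma moebius_transform_euler_factor:
  fixes f :: "nat \<Rightarrow> complex"
  assumes f: "multiplicative_fun f" and p: "prime p" and B: "\<And>n. n > 0 \<Longrightarrow> norm (f n) \<le> B"
  defines "g \<equiv> \<lambda>n. moebius_transform f n / of_nat n"
  shows "summable (\<lambda>k. norm (g (p ^ k)))"
    and "(\<Sum>k. g (p ^ k)) = (1 - 1 / of_nat p) * (\<Sum>k. f (p ^ k) / of_nat (p ^ k))"
    and "(\<Sum>k. norm (g (p ^ Suc k))) \<le> norm (1 - f p) / real p + 4 * B / real p ^ 2"
proof -
  define a where "a k = f (p ^ k) / of_nat (p ^ k)" for k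
  have p2: "real p \<ge> 2" using prime_ge_2_nat[OF p] by simp
  have p1: "p > 1" using p by (rule prime_gt_1_nat)
  have g: "multiplicative_fun g"
    unfolding g_def by (intro multiplicative_fun_divide_of_nat multiplicative_fun_moebius_transform)
  have a: "summable (\<lambda>k. norm (a k))"
    unfolding a_def by (rule summable_prime_power_series[OF p1 B])
  have gSuc: "g (p ^ Suc k) = a (Suc k) - (1 / of_nat p) * a k" for k
    unfolding g_def a_def moebius_transform_prime_power_Suc[OF p]
    by (simp add: diff_divide_distrib)
  have norm_gSuc: "norm (g (p ^ Suc k)) \<le> 2 * B * (1 / real p) ^ Suc k" for k
  proof -
    have "norm (f (p ^ Suc k) - f (p ^ k)) \<le> B + B"
      using B[of "p ^ Suc k"] B[of "p ^ k"] p1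
      by (intro order_trans[OF norm_triangle_ineq4] add_mono) auto
    then have "norm (f (p ^ Suc k) - f (p ^ k)) / real (p ^ Suc k) \<le> (B + B) / real (p ^ Suc k)"
      by (rule divide_right_mono) simp
    then show ?thesis
      unfolding g_def moebius_transform_prime_power_Suc[OF p]
      by (simp add: norm_divide norm_mult norm_power power_divide)
  qed
  have geo: "summable (\<lambda>k. 2 * B * (1 / real p) ^ Suc k)"
    using p1 by (intro summable_mult summable_Suc_iff[THEN iffD2] summable_geometric) simp
  have sumS: "summable (\<lambda>k. norm (g (p ^ Suc k)))"
    by (rule summable_comparison_test'[OF geo]) (use norm_gSuc in \<open>simp del: power_Suc\<close>)
  then show sumg: "summable (\<lambda>k. norm (g (p ^ k)))"
    using summable_Suc_iff[of "\<lambda>k. norm (g (p ^ k))"] by simp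
  have "(\<Sum>k. g (p ^ k)) = 1 + (\<Sum>k. a (Suc k) - (1 / of_nat p) * a k)"
    using local_euler_factor_split(1)[OF g sumg] by (simp only: gSuc)
  also have "\<dots> = 1 + (\<Sum>k. a (Suc k)) - (1 / of_nat p) * (\<Sum>k. a k)"
    using summable_norm_cancel[OF a] summable_Suc_iff[of a]
    by (simp add: suminf_diff[symmetric] suminf_divide)
  also have "1 + (\<Sum>k. a (Suc k)) = (\<Sum>k. a k)"
    using suminf_split_head[OF summable_norm_cancel[OF a]] multiplicative_funD(1)[OF f]
    by (simp add: a_def)
  finally show "(\<Sum>k. g (p ^ k)) = (1 - 1 / of_nat p) * (\<Sum>k. f (p ^ k) / of_nat (p ^ k))"
    by (simp add: a_def algebra_simps)
  have "B \<ge> 0" using order_trans[OF norm_ge_zero B[of 1]] by simp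
  have "(\<Sum>k. norm (g (p ^ Suc k))) = norm (g (p ^ Suc 0)) + (\<Sum>k. norm (g (p ^ Suc (Suc k))))"
    using suminf_split_head[OF sumS] by simp
  also have "norm (g (p ^ Suc 0)) = norm (1 - f p) / real p"
    unfolding g_def moebius_transform_prime_power_Suc[OF p]
    using multiplicative_funD(1)[OF f] by (simp add: norm_divide norm_minus_commute)
  also have "(\<Sum>k. norm (g (p ^ Suc (Suc k)))) \<le> (\<Sum>k. (2 * B / real p ^ 2) * (1 / real p) ^ k)"
  proof (rule suminf_le)
    show "norm (g (p ^ Suc (Suc k))) \<le> (2 * B / real p ^ 2) * (1 / real p) ^ k" for k
      using norm_gSuc[of "Suc k"] by (simp add: power2_eq_square field_simps)
    show "summable (\<lambda>k. norm (g (p ^ Suc (Suc k))))"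
      using sumS by (subst summable_Suc_iff)
    show "summable (\<lambda>k. (2 * B / real p ^ 2) * (1 / real p) ^ k)"
      using p1 by (intro summable_mult summable_geometric) simp
  qed
  also have "\<dots> = (2 * B / real p ^ 2) * (1 / (1 - 1 / real p))"
    using p1 by (subst suminf_mult) (simp_all add: suminf_geometric summable_geometric)
  also have "\<dots> \<le> (2 * B / real p ^ 2) * 2"
    using p2 \<open>B \<ge> 0\<close> by (intro mult_left_mono) (auto simp: field_simps)
  finally show "(\<Sum>k. norm (g (p ^ Suc k))) \<le> norm (1 - f p) / real p + 4 * B / real p ^ 2"
    by simp
qed

theorem theorem1p1:
  fixes f :: "nat \<Rightarrow> complex"
  assumes "multiplicative_fun f"
    and "bounded_partial_sums f"
    and "(\<lambda>p. norm (1 - f p) / real p) summable_on {p. prime p}"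
  shows "\<exists>q. prime q \<and> (\<lambda>k. f (q ^ k) / of_nat (q ^ k)) sums 0"
proof -
  obtain B where B: "B > 0" "\<And>n. n > 0 \<Longrightarrow> norm (f n) \<le> B"
    using bounded_of_bounded_partial_sums[OF assms(2)] by blast
  define g where "g n = moebius_transform f n / of_nat n" for n
  have g: "multiplicative_fun g"
    unfolding g_def by (intro multiplicative_fun_divide_of_nat multiplicative_fun_moebius_transform)
  have g0: "g 0 = 0" by (simp add: g_def)
  note factor = moebius_transform_euler_factor[OF assms(1) _ B(2), folded g_def]
  have "summable (\<lambda>p. if prime p then norm (1 - f p) / real p else 0)"
    using assms(3) by (intro summable_on_imp_summable)
      (subst summable_on_cong_neutral[where g = "\<lambda>p. norm (1 - f p) / real p" and T = "{p. prime p}"]; simp)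
  moreover have "summable (\<lambda>p. 4 * B * inverse (real p ^ 2))"
    by (intro summable_mult inverse_power_summable) simp
  ultimately have "summable (\<lambda>p. (if prime p then norm (1 - f p) / real p else 0)
      + 4 * B * inverse (real p ^ 2))"
    by (rule summable_add)
  then have sumP: "summable (\<lambda>p. if prime p then \<Sum>k. norm (g (p ^ Suc k)) else 0)"
  proof (rule summable_comparison_test')
    fix p :: nat
    have "(\<Sum>k. norm (g (p ^ Suc k))) \<ge> 0" if "prime p"
      using factor(1)[OF that] summable_Suc_iff[of "\<lambda>k. norm (g (p ^ k))"]
      by (intro suminf_nonneg) simp_all
    then show "norm (if prime p then \<Sum>k. norm (g (p ^ Suc k)) else 0)
        \<le> (if prime p then norm (1 - f p) / real p else 0) + 4 * B * inverse (real p ^ 2)"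
      using factor(3)[of p] B(1) by (auto simp: field_simps simp del: power_Suc)
  qed
  have "(\<lambda>N. (\<Sum>n=1..N. \<Sum>d | d dvd n. moebius_transform f d) / of_nat N) \<longlonglongrightarrow> (\<Sum>n. g n)"
    using summable_multiplicative_fun[OF g g0 factor(1) sumP] wintner_mean_value[of "moebius_transform f"]
    by (simp add: g_def)
  moreover have "(\<Sum>n=1..N. \<Sum>d | d dvd n. moebius_transform f d) = (\<Sum>n=1..N. f n)" for N
    by (intro sum.cong refl sum_divisors_moebius_transform[OF assms(1)]) simp
  ultimately have "(\<Sum>n. g n) = 0"
    using LIMSEQ_unique[OF _ mean_value_zero[OF assms(2)]] by simp
  then obtain q where q: "prime q" "(\<Sum>k. g (q ^ k)) = 0"
    using euler_product_zero_factor[OF g g0 factor(1) sumP] by blast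
  have "1 - 1 / (of_nat q :: complex) \<noteq> 0"
    using prime_gt_1_nat[OF q(1)] by simp
  then have "(\<Sum>k. f (q ^ k) / of_nat (q ^ k)) = 0"
    using factor(2)[OF q(1)] q(2) by (metis mult_eq_0_iff)
  moreover have "summable (\<lambda>k. f (q ^ k) / of_nat (q ^ k))"
    using summable_prime_power_series[OF prime_gt_1_nat[OF q(1)] B(2)] by (rule summable_norm_cancel)
  ultimately show ?thesis using q(1) by (metis summable_sums)
qed

end
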